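(* Let $\mathcal M=(M,\rho)$ be a finite pseudo-metric space joined by a connected graph $G=(V,E)$. Let $\Omega(\mathcal M,G)$ be the set of all weight functions $\omega:E\to[0,\infty)$ such that $(G,\omega)$ is a filling of $\mathcal M$, and let $\Omega_m(\mathcal M,G)$ be its subset of those $\omega$ for which $(G,\omega)$ is a minimal parametric filling of $\mathcal M$. Then $\Omega(\mathcal M,G)$ is closed and convex in the linear space $\mathbb R^E$ of all functions on $E$, and $\Omega_m(\mathcal M,G)\subset\Omega(\mathcal M,G)$ is a non-empty convex compact set.
   Context: In a pseudo-metric space the distance between distinct points may be $0$. A finite graph $G=(V,E)$ joins $M$ if it is connected and $M\subset V$. For a weight function $\omega:E\to[0,\infty)$, $d_\omega(u,v)$ is the least weight (sum of $\omega$ over edges) of a path in $G$ joining $u$ and $v$, and $\omega(G)=\sum_{e\in E}\omega(e)$. The weighted graph $(G,\omega)$ is a filling of $\mathcal M=(M,\rho)$ of type $G$ if $G$ joins $M$ and $\rho(p,q)\le d_\omega(p,q)$ for all $p,q\in M$. A minimal parametric filling of type $G$ of $\mathcal M$ is a filling $(G,\omega)$ of $\mathcal M$ whose weight $\omega(G)$ is equal to the infimum of $\omega'(G)$ over all fillings $(G,\omega')$ of $\mathcal M$ of the same type $G$. *)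

theory Defs
  imports "HOL-Analysis.Analysis"
begin

definition pseudo_metric_on :: "'v set \<Rightarrow> ('v \<Rightarrow> 'v \<Rightarrow> real) \<Rightarrow> bool" where
  "pseudo_metric_on M \<rho> \<longleftrightarrow>
     (\<forall>p\<in>M. \<forall>q\<in>M. 0 \<le> \<rho> p q) \<and>
     (\<forall>p\<in>M. \<rho> p p = 0) \<and>
     (\<forall>p\<in>M. \<forall>q\<in>M. \<rho> p q = \<rho> q p) \<and>
     (\<forall>p\<in>M. \<forall>q\<in>M. \<forall>r\<in>M. \<rho> p r \<le> \<rho> p q + \<rho> q r)"

definition finite_graph :: "'v set \<Rightarrow> 'v set set \<Rightarrow> bool" where
  "finite_graph V E \<longleftrightarrow> finite V \<and> E \<subseteq> {{u, v} |u v. u \<in> V \<and> v \<in> V \<and> u \<noteq> v}"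

(* A path is given by its list of pairwise distinct vertices; [u] is the path of length 0 at u. *)
definition graph_path :: "'v set \<Rightarrow> 'v set set \<Rightarrow> 'v \<Rightarrow> 'v list \<Rightarrow> 'v \<Rightarrow> bool" where
  "graph_path V E u xs v \<longleftrightarrow>
     xs \<noteq> [] \<and> hd xs = u \<and> last xs = v \<and> set xs \<subseteq> V \<and> distinct xs \<and>
     successively (\<lambda>x y. {x, y} \<in> E) xs"

definition connected_graph :: "'v set \<Rightarrow> 'v set set \<Rightarrow> bool" where
  "connected_graph V E \<longleftrightarrow> (\<forall>u\<in>V. \<forall>v\<in>V. \<exists>xs. graph_path V E u xs v)"

definition joins :: "'v set \<Rightarrow> 'v set set \<Rightarrow> 'v set \<Rightarrow> bool" where
  "joins V E M \<longleftrightarrow> finite_graph V E \<and> connected_graph V E \<and> M \<subseteq> V"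

definition path_weight :: "('v set \<Rightarrow> real) \<Rightarrow> 'v list \<Rightarrow> real" where
  "path_weight \<omega> xs = (\<Sum>(x, y)\<leftarrow>zip xs (tl xs). \<omega> {x, y})"

(* For u and v in a finite connected graph the set below is finite and non-empty. *)
definition weight_dist :: "'v set \<Rightarrow> 'v set set \<Rightarrow> ('v set \<Rightarrow> real) \<Rightarrow> 'v \<Rightarrow> 'v \<Rightarrow> real" where
  "weight_dist V E \<omega> u v = Min {path_weight \<omega> xs |xs. graph_path V E u xs v}"

definition graph_weight :: "'v set set \<Rightarrow> ('v set \<Rightarrow> real) \<Rightarrow> real" where
  "graph_weight E \<omega> = (\<Sum>e\<in>E. \<omega> e)"

(* Functions on E are represented by the extensional functions (undefined outside E), so that
   distinct elements of the carrier are distinct functions on E. *)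
definition filling ::
    "'v set \<Rightarrow> 'v set set \<Rightarrow> ('v set \<Rightarrow> real) \<Rightarrow> 'v set \<Rightarrow> ('v \<Rightarrow> 'v \<Rightarrow> real) \<Rightarrow> bool" where
  "filling V E \<omega> M \<rho> \<longleftrightarrow>
     joins V E M \<and> \<omega> \<in> E \<rightarrow>\<^sub>E {0..} \<and>
     (\<forall>p\<in>M. \<forall>q\<in>M. \<rho> p q \<le> weight_dist V E \<omega> p q)"

definition minimal_parametric_filling ::
    "'v set \<Rightarrow> 'v set set \<Rightarrow> ('v set \<Rightarrow> real) \<Rightarrow> 'v set \<Rightarrow> ('v \<Rightarrow> 'v \<Rightarrow> real) \<Rightarrow> bool" where
  "minimal_parametric_filling V E \<omega> M \<rho> \<longleftrightarrow>
     filling V E \<omega> M \<rho> \<and>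
     graph_weight E \<omega> = Inf {graph_weight E \<omega>' |\<omega>'. filling V E \<omega>' M \<rho>}"

definition Omega ::
    "'v set \<Rightarrow> ('v \<Rightarrow> 'v \<Rightarrow> real) \<Rightarrow> 'v set \<Rightarrow> 'v set set \<Rightarrow> ('v set \<Rightarrow> real) set" where
  "Omega M \<rho> V E = {\<omega>. filling V E \<omega> M \<rho>}"

definition Omega_min ::
    "'v set \<Rightarrow> ('v \<Rightarrow> 'v \<Rightarrow> real) \<Rightarrow> 'v set \<Rightarrow> 'v set set \<Rightarrow> ('v set \<Rightarrow> real) set" where
  "Omega_min M \<rho> V E = {\<omega>. minimal_parametric_filling V E \<omega> M \<rho>}"

(* The topological space of all functions E -> R.  For finite E this product topology is the
   usual (norm) topology of the linear space of functions on E. *)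
definition fun_space :: "'e set \<Rightarrow> ('e \<Rightarrow> real) topology" where
  "fun_space E = product_topology (\<lambda>_. euclideanreal) E"

(* Convexity in the linear space of functions on E.  The library's convex needs a type of class
   real_vector, which the extensional functions on a set E do not form. *)
definition convex_in_fun_space :: "'e set \<Rightarrow> ('e \<Rightarrow> real) set \<Rightarrow> bool" where
  "convex_in_fun_space E S \<longleftrightarrow>
     S \<subseteq> E \<rightarrow>\<^sub>E UNIV \<and>
     (\<forall>x\<in>S. \<forall>y\<in>S. \<forall>u\<ge>0. \<forall>v\<ge>0. u + v = 1 \<longrightarrow> (\<lambda>e\<in>E. u * x e + v * y e) \<in> S)"

end

theory Submission
  imports Defs
begin

text \<open>
  Since \<open>V\<close> is finite and paths have distinct vertices, the minimum defining \<^term>\<open>weight_dist\<close> runs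
  over a finite non-empty set. Hence the condition \<open>\<rho> p q \<le> weight_dist V E \<omega> p q\<close> is equivalent
  to the linear inequalities \<open>\<rho> p q \<le> path_weight \<omega> xs\<close>, one for each path \<open>xs\<close> from \<open>p\<close> to \<open>q\<close>
  (\<open>filling_iff\<close>). So \<open>\<Omega>\<close> is an intersection of closed half-spaces, which gives closedness and
  convexity. It is non-empty: assigning one sufficiently large constant
  to every edge gives a filling, because a path between distinct points has at
  least one edge (\<open>filling_exists\<close>).

  As all weights are non-negative, a sublevel set of the total weight on \<open>\<Omega>\<close> is a closed
  subset of a cube, hence compact (\<open>compactin_Omega_sublevel\<close>). The continuous total weight
  therefore attains its infimum on \<open>\<Omega>\<close>, and the set of minimizers is itself a sublevel set, at the
  level of the infimum (\<open>Omega_min_eq_sublevel\<close>); it is thus compact, convex and non-empty.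
\<close>

section \<open>The weight of a path\<close>

lemma path_weight_simps [simp]:
  "path_weight \<omega> [] = 0"
  "path_weight \<omega> [x] = 0"
  "path_weight \<omega> (x # y # xs) = \<omega> {x, y} + path_weight \<omega> (y # xs)"
  by (simp_all add: path_weight_def)

lemma continuous_map_path_weight:
  assumes "successively (\<lambda>x y. {x, y} \<in> E) xs"
  shows "continuous_map (fun_space E) euclideanreal (\<lambda>\<omega>. path_weight \<omega> xs)"
  using assms
proof (induction xs rule: induct_list012)
  case (3 x y zs)
  have "continuous_map (fun_space E) euclideanreal (\<lambda>\<omega>. \<omega> {x, y})"
    using 3 by (auto simp: fun_space_def intro: continuous_map_product_projection)
  with 3 show ?case by (auto intro: continuous_map_add)
qed simp_all

lemma path_weight_combination:
  assumes "successively (\<lambda>x y. {x, y} \<in> E) xs"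
  shows "path_weight (\<lambda>e\<in>E. u * \<omega> e + v * \<omega>' e) xs = u * path_weight \<omega> xs + v * path_weight \<omega>' xs"
  using assms by (induction xs rule: induct_list012) (auto simp: algebra_simps)

lemma path_weight_nonneg:
  assumes "successively (\<lambda>x y. {x, y} \<in> E) xs" and "\<And>e. e \<in> E \<Longrightarrow> 0 \<le> \<omega> e"
  shows "0 \<le> path_weight \<omega> xs"
  using assms by (induction xs rule: induct_list012) auto

lemma path_weight_ge_edge_bound:
  assumes path: "graph_path V E p xs q" and "p \<noteq> q"
    and ge: "\<And>e. e \<in> E \<Longrightarrow> c \<le> \<omega> e" and "0 \<le> c"
  shows "c \<le> path_weight \<omega> xs"
proof -
  obtain x y zs where xs: "xs = x # y # zs"
    using path \<open>p \<noteq> q\<close> unfolding graph_path_def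
    by (cases xs rule: remdups_adj.cases) auto
  have succ: "{x, y} \<in> E" "successively (\<lambda>x y. {x, y} \<in> E) (y # zs)"
    using path by (auto simp: graph_path_def xs)
  have "0 \<le> path_weight \<omega> (y # zs)"
    using succ(2) ge \<open>0 \<le> c\<close> by (intro path_weight_nonneg[of E]) (auto intro: order_trans)
  with ge[OF succ(1)] show ?thesis by (simp add: xs)
qed

section \<open>Fillings as solutions of linear inequalities\<close>

lemma joins_finite_edges:
  assumes "joins V E M" shows "finite E"
proof -
  have "finite V" "E \<subseteq> Pow V" using assms by (auto simp: joins_def finite_graph_def)
  then show ?thesis by (meson finite_Pow_iff finite_subset)
qed

lemma filling_iff:
  assumes J: "joins V E M"
  shows "filling V E \<omega> M \<rho> \<longleftrightarrow> \<omega> \<in> E \<rightarrow>\<^sub>E {0..} \<and>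
    (\<forall>p\<in>M. \<forall>q\<in>M. \<forall>xs. graph_path V E p xs q \<longrightarrow> \<rho> p q \<le> path_weight \<omega> xs)"
proof -
  have "\<rho> p q \<le> weight_dist V E \<omega> p q \<longleftrightarrow>
      (\<forall>xs. graph_path V E p xs q \<longrightarrow> \<rho> p q \<le> path_weight \<omega> xs)"
    if "p \<in> M" "q \<in> M" for p q
  proof -
    have "finite V" using J by (auto simp: joins_def finite_graph_def)
    then have "finite {xs. set xs \<subseteq> V \<and> distinct xs}" by (rule finite_subset_distinct)
    moreover have "{xs. graph_path V E p xs q} \<subseteq> {xs. set xs \<subseteq> V \<and> distinct xs}"
      by (auto simp: graph_path_def)
    ultimately have "finite {xs. graph_path V E p xs q}" by (rule rev_finite_subset)
    then have fin: "finite {path_weight \<omega> xs |xs. graph_path V E p xs q}" by simp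
    have ne: "{path_weight \<omega> xs |xs. graph_path V E p xs q} \<noteq> {}"
      using J that unfolding joins_def connected_graph_def by blast
    show ?thesis unfolding weight_dist_def Min_ge_iff[OF fin ne] by blast
  qed
  then show ?thesis using J by (simp add: filling_def)
qed

lemma filling_exists:
  assumes "finite M" and \<rho>: "pseudo_metric_on M \<rho>" and J: "joins V E M"
  shows "\<exists>\<omega>. filling V E \<omega> M \<rho>"
proof -
  define c where "c = (\<Sum>(p, q)\<in>M \<times> M. \<rho> p q)"
  have nonneg: "0 \<le> \<rho> p q" if "p \<in> M" "q \<in> M" for p q
    using \<rho> that by (auto simp: pseudo_metric_on_def)
  have c0: "0 \<le> c" unfolding c_def by (rule sum_nonneg) (auto intro: nonneg)
  have cge: "\<rho> p q \<le> c" if "p \<in> M" "q \<in> M" for p q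
    using member_le_sum[of "(p, q)" "M \<times> M" "\<lambda>(p, q). \<rho> p q"] that nonneg \<open>finite M\<close>
    by (auto simp: c_def)
  have "\<rho> p q \<le> path_weight (\<lambda>e\<in>E. c) xs"
    if pq: "p \<in> M" "q \<in> M" and path: "graph_path V E p xs q" for p q xs
  proof (cases "p = q")
    case True
    then have "\<rho> p q = 0" using \<rho> pq by (auto simp: pseudo_metric_on_def)
    then show ?thesis
      using path c0 path_weight_nonneg[of E xs "\<lambda>e\<in>E. c"] by (simp add: graph_path_def)
  next
    case False
    then have "c \<le> path_weight (\<lambda>e\<in>E. c) xs"
      using path c0 by (intro path_weight_ge_edge_bound) auto
    then show ?thesis using cge[OF pq] by simp
  qed
  then have "filling V E (\<lambda>e\<in>E. c) M \<rho>" using c0 by (auto simp: filling_iff[OF J])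
  then show ?thesis by blast
qed

lemma closedin_Omega:
  assumes J: "joins V E M"
  shows "closedin (fun_space E) (Omega M \<rho> V E)"
proof -
  define P where "P = {(p, q, xs). p \<in> M \<and> q \<in> M \<and> graph_path V E p xs q}"
  define H where "H = (\<lambda>(p, q, xs). {\<omega> \<in> topspace (fun_space E). path_weight \<omega> xs \<in> {\<rho> p q..}})"
  \<comment> \<open>The orthant is included so that the family is non-empty even when \<open>M\<close> is empty.\<close>
  define F where "F = insert (E \<rightarrow>\<^sub>E {0..}) (H ` P)"
  have "closedin (fun_space E) (H i)" if i: "i \<in> P" for i
  proof -
    obtain p q xs where i': "i = (p, q, xs)" by (cases i)
    with i have "continuous_map (fun_space E) euclideanreal (\<lambda>\<omega>. path_weight \<omega> xs)"
      by (intro continuous_map_path_weight) (auto simp: P_def graph_path_def)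
    then show ?thesis unfolding H_def i' prod.case
      by (rule closedin_continuous_map_preimage) auto
  qed
  moreover have "closedin (fun_space E) (E \<rightarrow>\<^sub>E {0..})"
    by (simp add: fun_space_def closedin_product_topology)
  ultimately have "closedin (fun_space E) (\<Inter>F)" by (intro closedin_Inter) (auto simp: F_def)
  moreover have "Omega M \<rho> V E = \<Inter>F"
    by (auto simp: Omega_def F_def H_def P_def filling_iff[OF J] fun_space_def)
  ultimately show ?thesis by simp
qed

lemma convex_Omega:
  assumes J: "joins V E M"
  shows "convex_in_fun_space E (Omega M \<rho> V E)"
  unfolding convex_in_fun_space_def
proof (intro conjI ballI allI impI)
  show "Omega M \<rho> V E \<subseteq> E \<rightarrow>\<^sub>E UNIV" by (auto simp: Omega_def filling_def)
next
  fix \<omega> \<omega>' and u v :: real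
  assume \<omega>: "\<omega> \<in> Omega M \<rho> V E" "\<omega>' \<in> Omega M \<rho> V E" and uv: "0 \<le> u" "0 \<le> v" "u + v = 1"
  have "\<rho> p q \<le> path_weight (\<lambda>e\<in>E. u * \<omega> e + v * \<omega>' e) xs"
    if pq: "p \<in> M" "q \<in> M" and path: "graph_path V E p xs q" for p q xs
  proof -
    have "\<rho> p q = u * \<rho> p q + v * \<rho> p q" using uv by (metis distrib_right mult_1)
    also have "\<dots> \<le> u * path_weight \<omega> xs + v * path_weight \<omega>' xs"
      using \<omega> pq path uv by (auto simp: Omega_def filling_iff[OF J] intro!: add_mono mult_left_mono)
    also have "\<dots> = path_weight (\<lambda>e\<in>E. u * \<omega> e + v * \<omega>' e) xs"
      using path by (simp add: path_weight_combination graph_path_def)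
    finally show ?thesis .
  qed
  then show "(\<lambda>e\<in>E. u * \<omega> e + v * \<omega>' e) \<in> Omega M \<rho> V E"
    using \<omega> uv by (auto simp: Omega_def filling_iff[OF J] PiE_iff)
qed

section \<open>Sublevel sets of the total weight\<close>

lemma continuous_map_graph_weight:
  "finite E \<Longrightarrow> continuous_map (fun_space E) euclideanreal (graph_weight E)"
  unfolding graph_weight_def fun_space_def
  by (intro continuous_map_sum continuous_map_product_projection) auto

text \<open>Each edge weight is non-negative, so it is bounded by the total weight; the sublevel set is
  therefore contained in the compact cube of functions on \<open>E\<close> with values in \<open>[0, a]\<close>.\<close>

lemma compactin_Omega_sublevel:
  assumes J: "joins V E M"
  shows "compactin (fun_space E) {\<omega> \<in> Omega M \<rho> V E. graph_weight E \<omega> \<le> a}"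
proof -
  have fin: "finite E" using J by (rule joins_finite_edges)
  have "closedin (fun_space E) {\<omega> \<in> topspace (fun_space E). graph_weight E \<omega> \<in> {..a}}"
    by (rule closedin_continuous_map_preimage[OF continuous_map_graph_weight[OF fin]]) auto
  then have "closedin (fun_space E)
      (Omega M \<rho> V E \<inter> {\<omega> \<in> topspace (fun_space E). graph_weight E \<omega> \<in> {..a}})"
    using closedin_Omega[OF J] by (rule closedin_Int[rotated])
  moreover have "Omega M \<rho> V E \<inter> {\<omega> \<in> topspace (fun_space E). graph_weight E \<omega> \<in> {..a}}
      = {\<omega> \<in> Omega M \<rho> V E. graph_weight E \<omega> \<le> a}"
    using closedin_subset[OF closedin_Omega[OF J]] by auto
  ultimately have cl: "closedin (fun_space E) {\<omega> \<in> Omega M \<rho> V E. graph_weight E \<omega> \<le> a}"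
    by simp
  have "compactin (fun_space E) (E \<rightarrow>\<^sub>E {0..a})"
    unfolding fun_space_def compactin_PiE by simp
  moreover have "{\<omega> \<in> Omega M \<rho> V E. graph_weight E \<omega> \<le> a} \<subseteq> E \<rightarrow>\<^sub>E {0..a}"
  proof
    fix \<omega> assume "\<omega> \<in> {\<omega> \<in> Omega M \<rho> V E. graph_weight E \<omega> \<le> a}"
    then have \<omega>: "\<omega> \<in> E \<rightarrow>\<^sub>E {0..}" and le: "graph_weight E \<omega> \<le> a"
      by (auto simp: Omega_def filling_def)
    have "\<omega> e \<le> a" if "e \<in> E" for e
    proof -
      have "\<omega> e \<le> sum \<omega> E" using \<omega> fin that by (intro member_le_sum) auto
      with le show ?thesis by (simp add: graph_weight_def)
    qed
    with \<omega> show "\<omega> \<in> E \<rightarrow>\<^sub>E {0..a}" by (auto simp: PiE_iff)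
  qed
  ultimately show ?thesis using cl by (rule closed_compactin)
qed

lemma convex_Omega_sublevel:
  assumes J: "joins V E M"
  shows "convex_in_fun_space E {\<omega> \<in> Omega M \<rho> V E. graph_weight E \<omega> \<le> a}"
proof -
  have "graph_weight E (\<lambda>e\<in>E. u * \<omega> e + v * \<omega>' e) \<le> a"
    if uv: "0 \<le> u" "0 \<le> v" "u + v = 1" and le: "graph_weight E \<omega> \<le> a" "graph_weight E \<omega>' \<le> a"
    for \<omega> \<omega>' and u v :: real
  proof -
    have "graph_weight E (\<lambda>e\<in>E. u * \<omega> e + v * \<omega>' e) = u * graph_weight E \<omega> + v * graph_weight E \<omega>'"
      by (simp add: graph_weight_def sum.distrib sum_distrib_left)
    also have "\<dots> \<le> a" using le uv by (intro convex_bound_le)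
    finally show ?thesis .
  qed
  then show ?thesis using convex_Omega[OF J, of \<rho>] unfolding convex_in_fun_space_def by blast
qed

section \<open>Fillings of minimal total weight\<close>

lemma graph_weight_attains_min_on_Omega:
  assumes J: "joins V E M" and "\<omega>\<^sub>0 \<in> Omega M \<rho> V E"
  obtains \<omega> where "\<omega> \<in> Omega M \<rho> V E"
    and "\<And>\<omega>'. \<omega>' \<in> Omega M \<rho> V E \<Longrightarrow> graph_weight E \<omega> \<le> graph_weight E \<omega>'"
proof -
  define K where "K = {\<omega> \<in> Omega M \<rho> V E. graph_weight E \<omega> \<le> graph_weight E \<omega>\<^sub>0}"
  have "compactin (fun_space E) K" unfolding K_def by (rule compactin_Omega_sublevel[OF J])
  then have "compactin euclideanreal (graph_weight E ` K)"
    by (rule image_compactin) (rule continuous_map_graph_weight[OF joins_finite_edges[OF J]])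
  then have "compact (graph_weight E ` K)" by simp
  moreover have "\<omega>\<^sub>0 \<in> K" using assms(2) by (simp add: K_def)
  then have "graph_weight E ` K \<noteq> {}" by blast
  ultimately obtain \<omega> where \<omega>: "\<omega> \<in> K" "\<forall>\<omega>'\<in>K. graph_weight E \<omega> \<le> graph_weight E \<omega>'"
    using compact_attains_inf[of "graph_weight E ` K"] by auto
  show ?thesis
  proof
    show "\<omega> \<in> Omega M \<rho> V E" using \<omega> by (simp add: K_def)
    show "graph_weight E \<omega> \<le> graph_weight E \<omega>'" if "\<omega>' \<in> Omega M \<rho> V E" for \<omega>'
      using \<omega> that \<open>\<omega>\<^sub>0 \<in> K\<close> by (cases "\<omega>' \<in> K") (auto simp: K_def)
  qed
qed

lemma Omega_min_eq_sublevel: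
  "Omega_min M \<rho> V E =
     {\<omega> \<in> Omega M \<rho> V E. graph_weight E \<omega> \<le> Inf (graph_weight E ` Omega M \<rho> V E)}"
proof -
  have Inf_le: "Inf (graph_weight E ` Omega M \<rho> V E) \<le> graph_weight E \<omega>"
    if "\<omega> \<in> Omega M \<rho> V E" for \<omega>
  proof (rule cInf_lower)
    show "bdd_below (graph_weight E ` Omega M \<rho> V E)"
      by (rule bdd_belowI2[where m = 0])
        (auto simp: Omega_def filling_def graph_weight_def intro!: sum_nonneg)
  qed (use that in simp)
  have "{graph_weight E \<omega>' |\<omega>'. filling V E \<omega>' M \<rho>} = graph_weight E ` Omega M \<rho> V E"
    by (auto simp: Omega_def)
  then have "Omega_min M \<rho> V E =
      {\<omega> \<in> Omega M \<rho> V E. graph_weight E \<omega> = Inf (graph_weight E ` Omega M \<rho> V E)}"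
    by (simp add: Omega_min_def minimal_parametric_filling_def Omega_def)
  also have "\<dots> = {\<omega> \<in> Omega M \<rho> V E. graph_weight E \<omega> \<le> Inf (graph_weight E ` Omega M \<rho> V E)}"
    using Inf_le by (auto intro: antisym)
  finally show ?thesis .
qed

theorem mainTheorem6:
  fixes M V :: "'v set" and E :: "'v set set" and \<rho> :: "'v \<Rightarrow> 'v \<Rightarrow> real"
  assumes "finite M" and "pseudo_metric_on M \<rho>" and "joins V E M"
  shows "closedin (fun_space E) (Omega M \<rho> V E) \<and>
         convex_in_fun_space E (Omega M \<rho> V E) \<and>
         Omega_min M \<rho> V E \<subseteq> Omega M \<rho> V E \<and>
         Omega_min M \<rho> V E \<noteq> {} \<and>
         convex_in_fun_space E (Omega_min M \<rho> V E) \<and>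
         compactin (fun_space E) (Omega_min M \<rho> V E)"
proof -
  obtain \<omega>\<^sub>0 where "\<omega>\<^sub>0 \<in> Omega M \<rho> V E" using filling_exists[OF assms] by (auto simp: Omega_def)
  then obtain \<omega> where \<omega>: "\<omega> \<in> Omega M \<rho> V E"
    "\<And>\<omega>'. \<omega>' \<in> Omega M \<rho> V E \<Longrightarrow> graph_weight E \<omega> \<le> graph_weight E \<omega>'"
    using graph_weight_attains_min_on_Omega[OF assms(3)] by blast
  have "graph_weight E \<omega> \<le> Inf (graph_weight E ` Omega M \<rho> V E)"
    using \<omega> by (intro cINF_greatest) auto
  then have "\<omega> \<in> Omega_min M \<rho> V E" using \<omega>(1) by (simp add: Omega_min_eq_sublevel)
  moreover have "convex_in_fun_space E (Omega_min M \<rho> V E)"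
    unfolding Omega_min_eq_sublevel by (rule convex_Omega_sublevel[OF assms(3)])
  moreover have "compactin (fun_space E) (Omega_min M \<rho> V E)"
    unfolding Omega_min_eq_sublevel by (rule compactin_Omega_sublevel[OF assms(3)])
  moreover have "Omega_min M \<rho> V E \<subseteq> Omega M \<rho> V E" by (auto simp: Omega_min_eq_sublevel)
  ultimately show ?thesis
    using closedin_Omega[OF assms(3)] convex_Omega[OF assms(3)] by blast
qed

end
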